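(* Let $n,d$ be positive integers, let $S=\mathbb{C}[x_0,\ldots,x_n]$ with the standard grading, let $I\subset S$ be the ideal generated by the $2^n$ forms $(x_0\pm x_1\pm\cdots\pm x_n)^d$, and let $R=S/I$. Then $R_{2d-1}=0$, i.e. $I$ contains all forms of degree $2d-1$.
   Context: $R_i$ denotes the homogeneous component of degree $i$ of $R$. *)

theory Defs
  imports Complex_Main "HOL-Library.Poly_Mapping" "HOL-Algebra.QuotRing"
begin

text \<open>
  A monomial is a finitely supported exponent vector \<open>nat \<Rightarrow>\<^sub>0 nat\<close>, and a polynomial a finitely
  supported map from monomials to coefficients, multiplied by convolution. This allows infinitely
  many variables; the polynomial ring in \<open>x\<^sub>0, \<dots>, x\<^sub>n\<close> is cut out as a carrier set.
\<close>

type_synonym cpoly = "(nat \<Rightarrow>\<^sub>0 nat) \<Rightarrow>\<^sub>0 complex"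

definition Var :: "nat \<Rightarrow> cpoly" where
  "Var i = Poly_Mapping.single (Poly_Mapping.single i 1) 1"

definition mdeg :: "(nat \<Rightarrow>\<^sub>0 nat) \<Rightarrow> nat" where
  "mdeg m = (\<Sum>i\<in>Poly_Mapping.keys m. Poly_Mapping.lookup m i)"

definition polys :: "nat \<Rightarrow> cpoly set" where
  "polys n = {p. \<forall>m\<in>Poly_Mapping.keys p. Poly_Mapping.keys m \<subseteq> {0..n}}"

definition poly_ring :: "nat \<Rightarrow> cpoly ring" where
  "poly_ring n = \<lparr>carrier = polys n, monoid.mult = (*), one = 1, zero = 0, add = (+)\<rparr>"

text \<open>The homogeneous component of degree \<open>k\<close>, which contains \<open>0\<close>.\<close>

definition forms :: "nat \<Rightarrow> nat \<Rightarrow> cpoly set" where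
  "forms n k = {p \<in> polys n. \<forall>m\<in>Poly_Mapping.keys p. mdeg m = k}"

definition sign_form :: "nat \<Rightarrow> (nat \<Rightarrow> int) \<Rightarrow> cpoly" where
  "sign_form n \<epsilon> = Var 0 + (\<Sum>i=1..n. of_int (\<epsilon> i) * Var i)"

text \<open>Values of \<open>\<epsilon>\<close> outside \<open>{1..n}\<close> are irrelevant, so this set has \<open>2 ^ n\<close> elements for \<open>d > 0\<close>.\<close>

definition power_gens :: "nat \<Rightarrow> nat \<Rightarrow> cpoly set" where
  "power_gens n d = {sign_form n \<epsilon> ^ d | \<epsilon>. \<forall>i\<in>{1..n}. \<epsilon> i \<in> {1, -1}}"

definition power_ideal :: "nat \<Rightarrow> nat \<Rightarrow> cpoly set" where
  "power_ideal n d = genideal (poly_ring n) (power_gens n d)"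

definition quot_ring :: "nat \<Rightarrow> nat \<Rightarrow> cpoly set ring" where
  "quot_ring n d = poly_ring n Quot power_ideal n d"

text \<open>As the ideal is homogeneous, the quotient is graded by the images of the \<open>forms n k\<close>.\<close>

definition quot_component :: "nat \<Rightarrow> nat \<Rightarrow> nat \<Rightarrow> cpoly set set" where
  "quot_component n d k = (\<lambda>p. power_ideal n d +>\<^bsub>poly_ring n\<^esub> p) ` forms n k"

text \<open>\<open>genideal\<close> is only meaningful over a ring and for generators in its carrier.\<close>

lemma polys_0: "0 \<in> polys n"
  by (simp add: polys_def)

lemma polys_1: "1 \<in> polys n"
  by (simp add: polys_def flip: single_one)

lemma polys_add: "p \<in> polys n \<Longrightarrow> q \<in> polys n \<Longrightarrow> p + q \<in> polys n"
  using Poly_Mapping.keys_add[of p q] unfolding polys_def by blast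

lemma polys_uminus: "p \<in> polys n \<Longrightarrow> - p \<in> polys n"
  by (simp add: polys_def)

lemma polys_mult:
  assumes "p \<in> polys n" "q \<in> polys n"
  shows "p * q \<in> polys n"
  unfolding polys_def
proof (intro CollectI ballI)
  fix m assume "m \<in> Poly_Mapping.keys (p * q)"
  then obtain a b where "m = a + b" "a \<in> Poly_Mapping.keys p" "b \<in> Poly_Mapping.keys q"
    using keys_mult[of p q] by blast
  then show "Poly_Mapping.keys m \<subseteq> {0..n}"
    using assms Poly_Mapping.keys_add[of a b] unfolding polys_def by blast
qed

lemma polys_power: "p \<in> polys n \<Longrightarrow> p ^ d \<in> polys n"
  by (induction d) (auto intro: polys_1 polys_mult)

lemma polys_Var: "i \<le> n \<Longrightarrow> Var i \<in> polys n"
  by (simp add: polys_def Var_def)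

lemma polys_sum: "(\<And>i. i \<in> A \<Longrightarrow> f i \<in> polys n) \<Longrightarrow> sum f A \<in> polys n"
  by (induction A rule: infinite_finite_induct) (auto intro: polys_0 polys_add)

lemma polys_of_int: "of_int c \<in> polys n"
proof -
  have nat: "of_nat k \<in> polys n" for k
    by (induction k) (auto intro: polys_0 polys_1 polys_add)
  show ?thesis
    by (cases c) (auto intro!: nat polys_uminus simp del: of_int_minus
        simp: of_int_minus[of "int _"] of_int_of_nat_eq simp flip: of_nat_Suc)
qed

lemma poly_ring_cring: "cring (poly_ring n)"
proof (rule cringI)
  show "abelian_group (poly_ring n)"
    by (rule abelian_groupI)
       (auto simp: poly_ring_def polys_0 polys_add add.assoc add.commute
          intro: polys_uminus bexI[of _ "- _"])
  show "Group.comm_monoid (poly_ring n)"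
    by (rule comm_monoidI) (auto simp: poly_ring_def polys_1 polys_mult mult.assoc mult.commute)
qed (auto simp: poly_ring_def distrib_right)

lemma power_gens_subset: "power_gens n d \<subseteq> carrier (poly_ring n)"
  by (auto simp: power_gens_def sign_form_def poly_ring_def
      intro!: polys_power polys_add polys_sum polys_mult polys_of_int polys_Var)

lemma ideal_power_ideal: "ideal (power_ideal n d) (poly_ring n)"
  unfolding power_ideal_def
  using ring.genideal_ideal[OF cring.axioms(1)[OF poly_ring_cring] power_gens_subset] .

end

theory Submission
  imports Defs "HOL-Library.FuncSet"
begin

text \<open>
  Put \<open>N = 2 * d - 1\<close> and let \<open>X\<^sup>\<tau>\<close> be a monomial of degree \<open>N\<close>; the claim is that \<open>X\<^sup>\<tau>\<close> lies
  in the ideal \<open>I\<close> generated by the powers \<open>\<ell>\<^sub>\<epsilon>\<^sup>d\<close> of the forms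
  \<open>\<ell>\<^sub>\<epsilon> = x\<^sub>0 + \<epsilon>\<^sub>1 x\<^sub>1 + \<dots> + \<epsilon>\<^sub>n x\<^sub>n\<close>. Two devices isolate \<open>X\<^sup>\<tau>\<close>.

  \<^item> \<^emph>\<open>Parity.\<close> In \<open>T = (\<Sum>\<epsilon>. \<epsilon>\<^sup>\<tau> \<ell>\<^sub>\<epsilon>\<^sup>N)\<close> only those monomials \<open>X\<^sup>\<alpha>\<close> survive for which
    \<open>\<alpha>\<^sub>i\<close> and \<open>\<tau>\<^sub>i\<close> have the same parity for every \<open>i\<close>.

  \<^item> \<^emph>\<open>Euler operators.\<close> The operator \<open>x\<^sub>i \<partial>\<^sub>i - c\<close> multiplies \<open>X\<^sup>\<alpha>\<close> by \<open>\<alpha>\<^sub>i - c\<close>, and, being a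
    derivation minus a scalar, maps the multiples of \<open>\<ell>\<^sup>m\<^sup>+\<^sup>1\<close> to multiples of \<open>\<ell>\<^sup>m\<close>. Let \<open>D\<close> be
    the composition of these operators over all pairs \<open>(i, c)\<close> such that \<open>c < \<tau>\<^sub>i\<close> and \<open>c\<close> has
    the parity of \<open>\<tau>\<^sub>i\<close>. There are \<open>(\<Sum>i. \<tau>\<^sub>i div 2) \<le> d - 1\<close> of them, so \<open>D\<close> maps
    \<open>\<ell>\<^sub>\<epsilon>\<^sup>N\<close> to a multiple of \<open>\<ell>\<^sub>\<epsilon>\<^sup>d\<close>.

  Hence \<open>D T \<in> I\<close>. If \<open>X\<^sup>\<alpha>\<close> survives in \<open>T\<close> and \<open>\<alpha> \<noteq> \<tau>\<close>, then \<open>\<alpha>\<^sub>i < \<tau>\<^sub>i\<close> for some \<open>i\<close>, as both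
  have degree \<open>N\<close>, and the factor for \<open>(i, \<alpha>\<^sub>i)\<close> kills \<open>X\<^sup>\<alpha>\<close>. So \<open>D T\<close> is a scalar multiple of
  \<open>X\<^sup>\<tau>\<close>, and the scalar is not \<open>0\<close>. See \<open>diag_op_euler_power\<close>, \<open>sum_signs\<close> and
  \<open>monomial_in_power_ideal\<close>.
\<close>

section \<open>Diagonal operators on polynomials\<close>

text \<open>The linear operator that multiplies each monomial \<open>X\<^sup>\<alpha>\<close> by the scalar \<open>f \<alpha>\<close>.\<close>

definition diag_op :: "((nat \<Rightarrow>\<^sub>0 nat) \<Rightarrow> complex) \<Rightarrow> cpoly \<Rightarrow> cpoly" where
  "diag_op f p = Abs_poly_mapping (\<lambda>a. f a * Poly_Mapping.lookup p a)"

lemma lookup_diag_op: "Poly_Mapping.lookup (diag_op f p) a = f a * Poly_Mapping.lookup p a"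
proof -
  have "finite {a. f a * Poly_Mapping.lookup p a \<noteq> 0}"
    by (rule finite_subset[OF _ finite_lookup[of p]]) auto
  then show ?thesis by (simp add: diag_op_def)
qed

lemma diag_op_add: "diag_op f (p + q) = diag_op f p + diag_op f q"
  by (rule poly_mapping_eqI) (simp add: lookup_diag_op lookup_add algebra_simps)

lemma diag_op_zero: "diag_op f 0 = 0"
  by (rule poly_mapping_eqI) (simp add: lookup_diag_op)

lemma diag_op_sum: "diag_op f (sum p A) = (\<Sum>x\<in>A. diag_op f (p x))"
  by (induction A rule: infinite_finite_induct) (simp_all add: diag_op_zero diag_op_add)

lemma diag_op_single: "diag_op f (Poly_Mapping.single a c) = Poly_Mapping.single a (f a * c)"
  by (rule poly_mapping_eqI) (simp add: lookup_diag_op lookup_single when_def)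

lemma lookup_const_mult:
  "Poly_Mapping.lookup (Poly_Mapping.single 0 c * p :: cpoly) a = c * Poly_Mapping.lookup p a"
  by (simp add: Poly_Mapping.map.rep_eq when_def flip: mult_map_scale_conv_mult)

lemma diag_op_const_mult:
  "diag_op f (Poly_Mapping.single 0 c * p) = Poly_Mapping.single 0 c * diag_op f p"
  by (rule poly_mapping_eqI) (simp add: lookup_diag_op lookup_const_mult)

lemma diag_op_of_int_mult: "diag_op f (of_int k * p) = of_int k * diag_op f p"
  using diag_op_const_mult[of f "of_int k" p] by simp

lemma diag_op_diff_const:
  "diag_op (\<lambda>a. f a - c) p = diag_op f p - Poly_Mapping.single 0 c * p"
  by (rule poly_mapping_eqI)
     (simp add: lookup_diag_op lookup_minus lookup_const_mult left_diff_distrib)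

lemma diag_op_mult: "diag_op (\<lambda>a. f a * g a) p = diag_op f (diag_op g p)"
  by (rule poly_mapping_eqI) (simp add: lookup_diag_op)

lemma diag_op_one: "diag_op (\<lambda>a. 1) p = p"
  by (rule poly_mapping_eqI) (simp add: lookup_diag_op)

lemma polys_diag_op: "p \<in> polys n \<Longrightarrow> diag_op f p \<in> polys n"
  by (auto simp: polys_def in_keys_iff lookup_diag_op)

lemma polys_const: "Poly_Mapping.single 0 c \<in> polys n"
  by (simp add: polys_def)

lemma sum_of_terms:
  "(\<Sum>a\<in>Poly_Mapping.keys p. Poly_Mapping.single a (Poly_Mapping.lookup p a)) = p"
  by (rule poly_mapping_eqI)
     (simp add: lookup_sum lookup_single when_def sum.delta in_keys_iff)

text \<open>For \<open>f \<alpha> = \<alpha>\<^sub>i\<close> this is the Leibniz rule for the Euler operator \<open>x\<^sub>i \<partial>\<^sub>i\<close>.\<close>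

lemma diag_op_derivation:
  assumes add: "\<And>a b. f (a + b) = f a + f b"
  shows "diag_op f (p * q) = diag_op f p * q + p * diag_op f q"
proof -
  have mono: "diag_op f (Poly_Mapping.single a c * Poly_Mapping.single b e) =
      diag_op f (Poly_Mapping.single a c) * Poly_Mapping.single b e +
      Poly_Mapping.single a c * diag_op f (Poly_Mapping.single b e)" for a b c e
    by (simp add: mult_single diag_op_single add algebra_simps flip: single_add)
  define P where "P = (\<lambda>a. Poly_Mapping.single a (Poly_Mapping.lookup p a))"
  define Q where "Q = (\<lambda>a. Poly_Mapping.single a (Poly_Mapping.lookup q a))"
  have p: "p = sum P (Poly_Mapping.keys p)" and q: "q = sum Q (Poly_Mapping.keys q)"
    by (simp_all add: P_def Q_def sum_of_terms)
  have PQ: "diag_op f (P a * Q b) = diag_op f (P a) * Q b + P a * diag_op f (Q b)" for a b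
    by (simp add: P_def Q_def mono)
  have "diag_op f (sum P A * sum Q B) =
      diag_op f (sum P A) * sum Q B + sum P A * diag_op f (sum Q B)" for A B
    by (simp add: sum_product diag_op_sum PQ sum.distrib)
  from this[of "Poly_Mapping.keys p" "Poly_Mapping.keys q"] show ?thesis
    by (simp flip: p q)
qed

lemma derivation_power_mult:
  assumes add: "\<And>a b. f (a + b) = f a + f b"
  shows "diag_op f (l ^ Suc m * h) =
    l ^ m * (of_nat (Suc m) * diag_op f l * h + l * diag_op f h)"
proof (induction m arbitrary: h)
  case 0
  show ?case by (simp add: diag_op_derivation[OF add])
next
  case (Suc m)
  have "diag_op f (l ^ Suc (Suc m) * h) = diag_op f (l ^ Suc m * (l * h))"
    by (simp add: ac_simps)
  also have "\<dots> = l ^ m * (of_nat (Suc m) * diag_op f l * (l * h) + l * diag_op f (l * h))"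
    by (rule Suc.IH)
  also have "\<dots> = l ^ Suc m * (of_nat (Suc (Suc m)) * diag_op f l * h + l * diag_op f h)"
    by (simp add: diag_op_derivation[OF add] algebra_simps)
  finally show ?case .
qed

text \<open>
  The eigenvalue on \<open>X\<^sup>\<alpha>\<close> of the composition of the operators \<open>x\<^sub>i \<partial>\<^sub>i - c\<close> over all pairs
  \<open>(i, c)\<close> in \<open>K\<close>.
\<close>

definition euler_eigenvalue :: "(nat \<times> nat) set \<Rightarrow> (nat \<Rightarrow>\<^sub>0 nat) \<Rightarrow> complex" where
  "euler_eigenvalue K a = (\<Prod>(i, c)\<in>K. of_nat (Poly_Mapping.lookup a i) - of_nat c)"

text \<open>Each of the \<open>card K\<close> operators costs one factor \<open>l\<close>.\<close>

lemma diag_op_euler_power: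
  assumes "finite K" and "l \<in> polys n"
  shows "\<exists>h'\<in>polys n. diag_op (euler_eigenvalue K) (l ^ (m + card K)) = l ^ m * h'"
  using assms(1)
proof (induction K arbitrary: m rule: finite_induct)
  case empty
  have "euler_eigenvalue {} = (\<lambda>a. 1)" by (simp add: euler_eigenvalue_def fun_eq_iff)
  then show ?case by (auto simp: diag_op_one intro: bexI[of _ 1] polys_1)
next
  case (insert ic K)
  obtain i c where ic: "ic = (i, c)" by (cases ic)
  define g :: "(nat \<Rightarrow>\<^sub>0 nat) \<Rightarrow> complex" where "g = (\<lambda>a. of_nat (Poly_Mapping.lookup a i))"
  have g_add: "g (a + b) = g a + g b" for a b by (simp add: g_def lookup_add)
  obtain h where h: "h \<in> polys n"
    "diag_op (euler_eigenvalue K) (l ^ (Suc m + card K)) = l ^ Suc m * h"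
    using insert.IH[of "Suc m"] by blast
  let ?h' = "of_int (int (Suc m)) * diag_op g l * h + l * diag_op g h
    + - (Poly_Mapping.single 0 (of_nat c) * (l * h))"
  have "euler_eigenvalue (insert ic K) = (\<lambda>a. (g a - of_nat c) * euler_eigenvalue K a)"
    using insert.hyps by (simp add: euler_eigenvalue_def g_def ic fun_eq_iff)
  then have "diag_op (euler_eigenvalue (insert ic K)) (l ^ (m + card (insert ic K))) =
      diag_op (\<lambda>a. g a - of_nat c) (l ^ Suc m * h)"
    using insert.hyps h(2) by (simp add: diag_op_mult)
  also have "\<dots> = l ^ m * ?h'"
    unfolding diag_op_diff_const derivation_power_mult[OF g_add] by (simp add: algebra_simps)
  finally have "diag_op (euler_eigenvalue (insert ic K)) (l ^ (m + card (insert ic K))) =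
      l ^ m * ?h'" .
  moreover have "?h' \<in> polys n"
    by (intro polys_add polys_mult polys_uminus polys_diag_op polys_of_int polys_const h(1) assms(2))
  ultimately show ?case by blast
qed

section \<open>Monomials and powers of the sign forms\<close>

lemma mdeg_eq_sum:
  assumes "finite A" and "Poly_Mapping.keys a \<subseteq> A"
  shows "mdeg a = (\<Sum>i\<in>A. Poly_Mapping.lookup a i)"
  unfolding mdeg_def
  by (rule sum.mono_neutral_left) (use assms in \<open>auto simp: in_keys_iff\<close>)

text \<open>The exponent vector of the monomial \<open>x\<^bsub>g 0\<^esub> \<dots> x\<^bsub>g (N - 1)\<^esub>\<close>.\<close>

definition exps_of :: "nat \<Rightarrow> (nat \<Rightarrow> nat) \<Rightarrow> (nat \<Rightarrow>\<^sub>0 nat)" where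
  "exps_of N g = (\<Sum>j<N. Poly_Mapping.single (g j) 1)"

lemma lookup_exps_of: "Poly_Mapping.lookup (exps_of N g) i = card {j \<in> {..<N}. g j = i}"
  by (simp add: exps_of_def lookup_sum lookup_single when_def
      flip: sum.inter_filter)

lemma keys_exps_of:
  assumes "g \<in> {..<N} \<rightarrow>\<^sub>E {0..n}"
  shows "Poly_Mapping.keys (exps_of N g) \<subseteq> {0..n}"
proof
  fix i assume "i \<in> Poly_Mapping.keys (exps_of N g)"
  then have "{j \<in> {..<N}. g j = i} \<noteq> {}"
    by (auto simp: in_keys_iff lookup_exps_of simp del: Collect_empty_eq)
  then show "i \<in> {0..n}" using assms by (auto simp: PiE_iff)
qed

lemma prod_exps_of:
  fixes u :: "nat \<Rightarrow> 'a :: comm_monoid_mult"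
  assumes "g \<in> {..<N} \<rightarrow>\<^sub>E {0..n}"
  shows "(\<Prod>j<N. u (g j)) = (\<Prod>i\<in>{0..n}. u i ^ Poly_Mapping.lookup (exps_of N g) i)"
proof -
  have "(\<Prod>j<N. u (g j)) = (\<Prod>i\<in>{0..n}. \<Prod>j\<in>{j \<in> {..<N}. g j = i}. u (g j))"
    by (rule prod.group[symmetric]) (use assms in \<open>auto simp: PiE_iff\<close>)
  also have "\<dots> = (\<Prod>i\<in>{0..n}. \<Prod>j\<in>{j \<in> {..<N}. g j = i}. u i)"
    by (intro prod.cong) auto
  finally show ?thesis by (simp add: lookup_exps_of)
qed

lemma mdeg_exps_of:
  assumes "g \<in> {..<N} \<rightarrow>\<^sub>E {0..n}"
  shows "mdeg (exps_of N g) = N"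
proof -
  have "mdeg (exps_of N g) = (\<Sum>i\<in>{0..n}. card {j \<in> {..<N}. g j = i})"
    using mdeg_eq_sum[OF _ keys_exps_of[OF assms]] by (simp add: lookup_exps_of)
  also have "\<dots> = (\<Sum>i\<in>{0..n}. \<Sum>j\<in>{j \<in> {..<N}. g j = i}. 1)"
    by simp
  also have "\<dots> = (\<Sum>j<N. 1)"
    by (rule sum.group) (use assms in \<open>auto simp: PiE_iff\<close>)
  finally show ?thesis by simp
qed

lemma ex_exps_of:
  assumes "mdeg a = N" and "Poly_Mapping.keys a \<subseteq> {0..n}"
  shows "\<exists>g \<in> {..<N} \<rightarrow>\<^sub>E {0..n}. exps_of N g = a"
  using assms
proof (induction N arbitrary: a)
  case 0
  then have "Poly_Mapping.lookup a i = 0" for i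
    by (cases "i \<in> Poly_Mapping.keys a") (auto simp: mdeg_def in_keys_iff)
  then have "a = 0" by (intro poly_mapping_eqI) simp
  then show ?case by (auto simp: exps_of_def)
next
  case (Suc N)
  have "Poly_Mapping.keys a \<noteq> {}"
    using Suc.prems(1) by (auto simp: mdeg_def)
  then obtain i where i: "i \<in> Poly_Mapping.keys a" by blast
  define b where "b = a - Poly_Mapping.single i 1"
  have a: "a = b + Poly_Mapping.single i 1"
    using i by (intro poly_mapping_eqI)
      (auto simp: b_def lookup_add lookup_minus lookup_single when_def in_keys_iff)
  have keys: "Poly_Mapping.keys b \<subseteq> {0..n}"
    using Suc.prems(2) unfolding a by (auto simp: in_keys_iff lookup_add subset_iff)
  have "mdeg a = mdeg b + 1"
    unfolding mdeg_eq_sum[OF finite_atLeastAtMost Suc.prems(2)]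
      mdeg_eq_sum[OF finite_atLeastAtMost keys]
    using i Suc.prems(2) by (auto simp: a lookup_add lookup_single when_def sum.distrib)
  then obtain g where g: "g \<in> {..<N} \<rightarrow>\<^sub>E {0..n}" "exps_of N g = b"
    using Suc.IH[OF _ keys] Suc.prems(1) by auto
  have "exps_of (Suc N) (g(N := i)) = a"
    using g(2) by (simp add: a exps_of_def)
  moreover have "g(N := i) \<in> {..<Suc N} \<rightarrow>\<^sub>E {0..n}"
    using g(1) i Suc.prems(2) by (auto simp: PiE_iff extensional_def less_Suc_eq)
  ultimately show ?case by blast
qed

lemma prod_Var: "(\<Prod>j<N. Var (g j)) = Poly_Mapping.single (exps_of N g) 1"
  by (induction N) (simp_all add: exps_of_def Var_def mult_single)

text \<open>
  Expansion of a power of a sign form over words \<open>g\<close> of length \<open>N\<close> in the variables; a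
  monomial occurs here once for each of its words, so no multinomial coefficients appear.
\<close>

lemma sign_form_power:
  "sign_form n \<epsilon> ^ N = (\<Sum>g \<in> {..<N} \<rightarrow>\<^sub>E {0..n}.
     of_int (\<Prod>i\<in>{1..n}. \<epsilon> i ^ Poly_Mapping.lookup (exps_of N g) i) *
     Poly_Mapping.single (exps_of N g) 1)"
proof -
  define s where "s = \<epsilon>(0 := 1)"
  have split: "{0..n} = insert 0 {1..n}" by auto
  have "sign_form n \<epsilon> = (\<Sum>i\<in>{0..n}. of_int (s i) * Var i)"
    by (auto simp: sign_form_def s_def split intro!: sum.cong)
  then have "sign_form n \<epsilon> ^ N = (\<Prod>j<N. \<Sum>i\<in>{0..n}. of_int (s i) * Var i)"
    by simp
  also have "\<dots> = (\<Sum>g \<in> {..<N} \<rightarrow>\<^sub>E {0..n}. \<Prod>j<N. of_int (s (g j)) * Var (g j))"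
    by (rule prod_sum_PiE) auto
  also have "\<dots> = (\<Sum>g \<in> {..<N} \<rightarrow>\<^sub>E {0..n}.
     of_int (\<Prod>i\<in>{1..n}. \<epsilon> i ^ Poly_Mapping.lookup (exps_of N g) i) *
     Poly_Mapping.single (exps_of N g) 1)"
  proof (rule sum.cong)
    fix g assume g: "g \<in> {..<N} \<rightarrow>\<^sub>E {0..n}"
    have "(\<Prod>j<N. s (g j)) = (\<Prod>i\<in>{0..n}. s i ^ Poly_Mapping.lookup (exps_of N g) i)"
      by (rule prod_exps_of[OF g])
    also have "\<dots> = (\<Prod>i\<in>{1..n}. \<epsilon> i ^ Poly_Mapping.lookup (exps_of N g) i)"
      unfolding split by (auto simp: s_def intro!: prod.cong)
    finally show "(\<Prod>j<N. of_int (s (g j)) * Var (g j)) =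
        of_int (\<Prod>i\<in>{1..n}. \<epsilon> i ^ Poly_Mapping.lookup (exps_of N g) i) *
        Poly_Mapping.single (exps_of N g) 1"
      by (simp only: prod.distrib prod_Var flip: of_int_prod)
  qed simp
  finally show ?thesis .
qed

text \<open>Orthogonality of the characters of the group of sign changes.\<close>

lemma sum_signs:
  "(\<Sum>\<epsilon> \<in> {1..n} \<rightarrow>\<^sub>E {1, -1::int}. (\<Prod>i\<in>{1..n}. \<epsilon> i ^ a i) * (\<Prod>i\<in>{1..n}. \<epsilon> i ^ b i)) =
   (if \<forall>i\<in>{1..n}. even (a i + b i) then 2 ^ n else 0)"
proof -
  have "(\<Sum>\<epsilon> \<in> {1..n} \<rightarrow>\<^sub>E {1, -1::int}. (\<Prod>i\<in>{1..n}. \<epsilon> i ^ a i) * (\<Prod>i\<in>{1..n}. \<epsilon> i ^ b i)) =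
      (\<Sum>\<epsilon> \<in> {1..n} \<rightarrow>\<^sub>E {1, -1::int}. \<Prod>i\<in>{1..n}. \<epsilon> i ^ (a i + b i))"
    by (simp add: power_add prod.distrib)
  also have "\<dots> = (\<Prod>i\<in>{1..n}. \<Sum>e\<in>{1, -1::int}. e ^ (a i + b i))"
    by (rule prod_sum_PiE[symmetric]) auto
  also have "\<dots> = (\<Prod>i\<in>{1..n}. if even (a i + b i) then 2 else 0)"
    by (intro prod.cong refl) (simp add: minus_one_power_iff)
  also have "\<dots> = (if \<forall>i\<in>{1..n}. even (a i + b i) then 2 ^ n else 0)"
    by (auto simp: prod_zero_iff)
  finally show ?thesis .
qed

section \<open>Membership in the power ideal\<close>

lemma power_ideal_zero: "0 \<in> power_ideal n d"
  using additive_subgroup.zero_closed[OF ideal.axioms(1)[OF ideal_power_ideal[of n d]]]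
  by (simp add: poly_ring_def)

lemma power_ideal_add: "p \<in> power_ideal n d \<Longrightarrow> q \<in> power_ideal n d \<Longrightarrow> p + q \<in> power_ideal n d"
  using additive_subgroup.a_closed[OF ideal.axioms(1)[OF ideal_power_ideal[of n d]]]
  by (simp add: poly_ring_def)

lemma power_ideal_mult: "p \<in> power_ideal n d \<Longrightarrow> q \<in> polys n \<Longrightarrow> p * q \<in> power_ideal n d"
  using ideal.I_r_closed[OF ideal_power_ideal[of n d]] by (simp add: poly_ring_def)

lemma power_ideal_sum:
  "(\<And>x. x \<in> A \<Longrightarrow> p x \<in> power_ideal n d) \<Longrightarrow> sum p A \<in> power_ideal n d"
  by (induction A rule: infinite_finite_induct) (auto intro: power_ideal_zero power_ideal_add)

lemma power_ideal_gen:
  assumes "\<forall>i\<in>{1..n}. \<epsilon> i \<in> {1, -1}"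
  shows "sign_form n \<epsilon> ^ d \<in> power_ideal n d"
  using ring.genideal_self[OF cring.axioms(1)[OF poly_ring_cring] power_gens_subset[of n d]] assms
  unfolding power_ideal_def power_gens_def by blast

lemma polys_sign_form: "sign_form n \<epsilon> \<in> polys n"
  by (auto simp: sign_form_def intro!: polys_add polys_sum polys_mult polys_of_int polys_Var)

lemma monomial_in_power_ideal:
  assumes "d > 0" and deg: "mdeg t = 2 * d - 1" and keys: "Poly_Mapping.keys t \<subseteq> {0..n}"
  shows "Poly_Mapping.single t c \<in> power_ideal n d"
proof -
  define N where "N = 2 * d - 1"
  define \<tau> where "\<tau> = Poly_Mapping.lookup t"
  \<comment> \<open>\<open>K\<close> consists of the pairs \<open>(i, c)\<close> with \<open>c < \<tau> i\<close> and \<open>c\<close> of the parity of \<open>\<tau> i\<close>.\<close>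
  define K where "K = (SIGMA i:{0..n}. (\<lambda>k. \<tau> i mod 2 + 2 * k) ` {..<\<tau> i div 2})"
  define D where "D = diag_op (euler_eigenvalue K)"
  define E where "E = {1..n} \<rightarrow>\<^sub>E {1, -1::int}"
  define W where "W = {..<N} \<rightarrow>\<^sub>E {0..n}"
  define T where "T = (\<Sum>\<epsilon>\<in>E. of_int (\<Prod>i\<in>{1..n}. \<epsilon> i ^ \<tau> i) * sign_form n \<epsilon> ^ N)"
  have deg_sum: "(\<Sum>i\<in>{0..n}. \<tau> i) = N"
    using mdeg_eq_sum[OF _ keys] deg by (simp add: \<tau>_def N_def)
  have "finite K" by (auto simp: K_def)
  have finW: "finite W" by (auto simp: W_def intro!: finite_PiE)

  have K_iff: "(i, k) \<in> K \<longleftrightarrow> i \<le> n \<and> k < \<tau> i \<and> even (\<tau> i + k)" for i k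
  proof
    assume "(i, k) \<in> K"
    then obtain j where j: "i \<le> n" "j < \<tau> i div 2" "k = \<tau> i mod 2 + 2 * j"
      by (auto simp: K_def)
    then have "\<tau> i mod 2 + 2 * j < \<tau> i" "even (\<tau> i + (\<tau> i mod 2 + 2 * j))"
      by presburger+
    then show "i \<le> n \<and> k < \<tau> i \<and> even (\<tau> i + k)" using j by simp
  next
    assume *: "i \<le> n \<and> k < \<tau> i \<and> even (\<tau> i + k)"
    then have "k div 2 < \<tau> i div 2" "k = \<tau> i mod 2 + 2 * (k div 2)"
      by presburger+
    then show "(i, k) \<in> K" using * unfolding K_def by auto
  qed

  have "D T \<in> power_ideal n d"
  proof -
    have "card K = (\<Sum>i\<in>{0..n}. \<tau> i div 2)"
      unfolding K_def by (subst card_SigmaI) (auto simp: card_image inj_on_def)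
    then have "2 * card K = (\<Sum>i\<in>{0..n}. 2 * (\<tau> i div 2))"
      by (simp add: sum_distrib_left)
    also have "\<dots> \<le> N"
      unfolding deg_sum[symmetric] by (rule sum_mono) simp
    finally have cardK: "d + (d - 1 - card K) + card K = N" and "card K \<le> d - 1"
      using \<open>d > 0\<close> by (auto simp: N_def)
    have "D (sign_form n \<epsilon> ^ N) \<in> power_ideal n d" if "\<epsilon> \<in> E" for \<epsilon>
    proof -
      let ?l = "sign_form n \<epsilon>" and ?r = "d - 1 - card K"
      obtain h where h: "h \<in> polys n" "D (?l ^ N) = ?l ^ (d + ?r) * h"
        using diag_op_euler_power[OF \<open>finite K\<close> polys_sign_form[of n \<epsilon>], of "d + ?r"]
        unfolding D_def cardK by blast
      have "?l ^ d * (?l ^ ?r * h) \<in> power_ideal n d"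
        by (intro power_ideal_mult power_ideal_gen polys_mult polys_power polys_sign_form h(1))
           (use that in \<open>auto simp: E_def PiE_iff\<close>)
      then show ?thesis by (simp add: h(2) power_add mult.assoc)
    qed
    then have "of_int k * D (sign_form n \<epsilon> ^ N) \<in> power_ideal n d" if "\<epsilon> \<in> E" for \<epsilon> k
      using that by (subst mult.commute) (intro power_ideal_mult polys_of_int)
    then show ?thesis
      unfolding T_def D_def diag_op_sum diag_op_of_int_mult by (rule power_ideal_sum)
  qed

  moreover have "D T = Poly_Mapping.single t
      (2 ^ n * euler_eigenvalue K t * of_nat (card {g \<in> W. exps_of N g = t}))"
  proof -
    define coef where "coef = (\<lambda>g. \<Sum>\<epsilon>\<in>E. (\<Prod>i\<in>{1..n}. \<epsilon> i ^ \<tau> i) *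
      (\<Prod>i\<in>{1..n}. \<epsilon> i ^ Poly_Mapping.lookup (exps_of N g) i))"
    have "T = (\<Sum>\<epsilon>\<in>E. \<Sum>g\<in>W. of_int ((\<Prod>i\<in>{1..n}. \<epsilon> i ^ \<tau> i) *
        (\<Prod>i\<in>{1..n}. \<epsilon> i ^ Poly_Mapping.lookup (exps_of N g) i)) *
        Poly_Mapping.single (exps_of N g) 1)"
      unfolding T_def sign_form_power W_def[symmetric]
      by (simp only: sum_distrib_left of_int_mult mult.assoc)
    also have "\<dots> = (\<Sum>g\<in>W. of_int (coef g) * Poly_Mapping.single (exps_of N g) 1)"
      by (subst sum.swap) (simp only: coef_def of_int_sum sum_distrib_right)
    finally have "T = (\<Sum>g\<in>W. of_int (coef g) * Poly_Mapping.single (exps_of N g) 1)" .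
    then have "D T = (\<Sum>g\<in>W. of_int (coef g) *
        Poly_Mapping.single (exps_of N g) (euler_eigenvalue K (exps_of N g)))"
      unfolding D_def by (simp add: diag_op_sum diag_op_of_int_mult diag_op_single)
    also have "\<dots> = (\<Sum>g\<in>W. if exps_of N g = t
        then Poly_Mapping.single t (2 ^ n * euler_eigenvalue K t) else 0)"
    proof (rule sum.cong)
      fix g assume g: "g \<in> W"
      define \<alpha> where "\<alpha> = Poly_Mapping.lookup (exps_of N g)"
      have coef: "coef g = (if \<forall>i\<in>{1..n}. even (\<tau> i + \<alpha> i) then 2 ^ n else 0)"
        unfolding coef_def E_def \<alpha>_def by (rule sum_signs)
      have keys': "Poly_Mapping.keys (exps_of N g) \<subseteq> {0..n}"
        using g keys_exps_of by (simp add: W_def)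
      have deg_sum': "(\<Sum>i\<in>{0..n}. \<alpha> i) = N"
        using mdeg_eq_sum[OF _ keys'] mdeg_exps_of g by (simp add: \<alpha>_def W_def)
      show "of_int (coef g) * Poly_Mapping.single (exps_of N g) (euler_eigenvalue K (exps_of N g)) =
        (if exps_of N g = t then Poly_Mapping.single t (2 ^ n * euler_eigenvalue K t) else 0)"
      proof (cases "exps_of N g = t")
        case True
        then have "\<alpha> = \<tau>" by (simp add: \<alpha>_def \<tau>_def)
        then have "coef g = 2 ^ n" by (simp add: coef)
        then have "of_int (coef g) = (Poly_Mapping.single 0 (2 ^ n) :: cpoly)"
          by (metis of_int_numeral of_int_power single_of_int)
        then show ?thesis using True by (simp add: mult_single)
      next
        case neq: False
        show ?thesis
        proof (cases "\<forall>i\<in>{1..n}. even (\<tau> i + \<alpha> i)")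
          case True
          \<comment> \<open>The sign of \<open>x\<^sub>0\<close> is fixed, so its parity comes from the degree.\<close>
          have "even (\<Sum>i\<in>{0..n}. \<tau> i + \<alpha> i)"
            by (simp add: sum.distrib deg_sum deg_sum')
          moreover have "(\<Sum>i\<in>{0..n}. \<tau> i + \<alpha> i) = (\<tau> 0 + \<alpha> 0) + (\<Sum>i\<in>{1..n}. \<tau> i + \<alpha> i)"
            by (simp add: sum.atLeast_Suc_atMost)
          ultimately have "even ((\<tau> 0 + \<alpha> 0) + (\<Sum>i\<in>{1..n}. \<tau> i + \<alpha> i))"
            by (simp only:)
          moreover have "even (\<Sum>i\<in>{1..n}. \<tau> i + \<alpha> i)"
            using True by (intro dvd_sum) auto
          ultimately have "even (\<tau> 0 + \<alpha> 0)"
            using dvd_add_left_iff by blast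
          then have parity: "even (\<tau> i + \<alpha> i)" if "i \<le> n" for i
            using True that by (cases "i = 0") auto
          have "\<exists>i\<le>n. \<alpha> i < \<tau> i"
          proof (rule ccontr)
            assume "\<not> ?thesis"
            then have le: "\<tau> i \<le> \<alpha> i" if "i \<in> {0..n}" for i
              using that by (auto simp: not_less)
            have "\<tau> i = \<alpha> i" if "i \<in> {0..n}" for i
              by (rule sum_mono_inv[OF _ le that]) (simp_all add: deg_sum deg_sum')
            moreover have "\<tau> i = 0" "\<alpha> i = 0" if "i \<notin> {0..n}" for i
              using keys keys' that by (auto simp: \<tau>_def \<alpha>_def in_keys_iff)
            ultimately have "\<alpha> i = \<tau> i" for i by (cases "i \<in> {0..n}") simp_all
            then have "exps_of N g = t" by (intro poly_mapping_eqI) (simp add: \<alpha>_def \<tau>_def)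
            with neq show False ..
          qed
          then obtain i where "(i, \<alpha> i) \<in> K" using K_iff parity by blast
          then have "euler_eigenvalue K (exps_of N g) = 0"
            unfolding euler_eigenvalue_def using \<open>finite K\<close>
            by (intro prod_zero bexI[of _ "(i, \<alpha> i)"]) (auto simp: \<alpha>_def)
          then show ?thesis using neq by simp
        next
          case False
          then have "coef g = 0" unfolding coef by (rule if_not_P)
          then show ?thesis using neq by simp
        qed
      qed
    qed simp
    also have "\<dots> = of_nat (card {g \<in> W. exps_of N g = t}) *
        Poly_Mapping.single t (2 ^ n * euler_eigenvalue K t)"
      using finW by (simp flip: sum.inter_filter)
    also have "\<dots> = Poly_Mapping.single t
        (2 ^ n * euler_eigenvalue K t * of_nat (card {g \<in> W. exps_of N g = t}))"
      by (simp add: mult_single mult.commute flip: single_of_nat)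
    finally show ?thesis .
  qed

  moreover have "2 ^ n * euler_eigenvalue K t * of_nat (card {g \<in> W. exps_of N g = t}) \<noteq> 0"
  proof -
    have "euler_eigenvalue K t \<noteq> 0"
      unfolding euler_eigenvalue_def using \<open>finite K\<close> K_iff
      by (auto simp: prod_zero_iff simp flip: \<tau>_def)
    moreover have "card {g \<in> W. exps_of N g = t} \<noteq> 0"
      using ex_exps_of[OF deg keys] finW by (auto simp: W_def N_def)
    ultimately show ?thesis by simp
  qed
  ultimately obtain C where C: "Poly_Mapping.single t C \<in> power_ideal n d" "C \<noteq> 0"
    by metis
  have "Poly_Mapping.single t C * Poly_Mapping.single 0 (c / C) \<in> power_ideal n d"
    by (intro power_ideal_mult C(1) polys_const)
  then show ?thesis using C(2) by (simp add: mult_single)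
qed

theorem corollary3p7:
  fixes n d :: nat
  assumes "n > 0" and "d > 0"
  shows "quot_component n d (2 * d - 1) = {\<zero>\<^bsub>quot_ring n d\<^esub>} \<and>
         forms n (2 * d - 1) \<subseteq> power_ideal n d"
proof
  show sub: "forms n (2 * d - 1) \<subseteq> power_ideal n d"
  proof
    fix p assume p: "p \<in> forms n (2 * d - 1)"
    have "(\<Sum>a\<in>Poly_Mapping.keys p. Poly_Mapping.single a (Poly_Mapping.lookup p a))
        \<in> power_ideal n d"
      using p assms(2)
      by (intro power_ideal_sum monomial_in_power_ideal) (auto simp: forms_def polys_def)
    then show "p \<in> power_ideal n d" by (simp add: sum_of_terms)
  qed
  interpret ideal "power_ideal n d" "poly_ring n" by (rule ideal_power_ideal)
  have "power_ideal n d +>\<^bsub>poly_ring n\<^esub> p = power_ideal n d" if "p \<in> forms n (2 * d - 1)" for p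
    using sub that by (intro a_rcos_const) auto
  moreover have "0 \<in> forms n (2 * d - 1)" by (simp add: forms_def polys_0)
  ultimately have "quot_component n d (2 * d - 1) = {power_ideal n d}"
    unfolding quot_component_def by (auto simp: image_iff)
  then show "quot_component n d (2 * d - 1) = {\<zero>\<^bsub>quot_ring n d\<^esub>}"
    by (simp add: quot_ring_def FactRing_def)
qed

end
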